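(* Let $G=(V,E)$ be a finite simple graph with $V=\{v_1,\dots,v_n\}$, let $m\ge 1$, let $k_1,\dots,k_n$ and $L_1,\dots,L_m$ be nonnegative integers, and let $X^{(0)}\in\{0,1\}^{n\times m}$ satisfy $\sum_{c=1}^m X^{(0)}_{i,c}=k_i$ for all $i\in\{1,\dots,n\}$ and $\sum_{i=1}^n X^{(0)}_{i,c}=L_c$ for all $c\in\{1,\dots,m\}$. Let $\mathcal H_{\mathrm{dual}}$ be the complex linear span of the computational basis states $|x\rangle$ with $x\in\{0,1\}^{n\times m}$, $\sum_{c}x_{i,c}=k_i$ for all $i$, and $\sum_i x_{i,c}=L_c$ for all $c$. Then: (1) For all $1\le i<j\le n$, all $1\le c<c'\le m$ and all $\beta\in\mathbb R$, the plaquette unitary $U_\square(\beta)=\exp\bigl(-i\beta H_\square^{(i,j;c,c')}\bigr)$ preserves all row sums and all column sums, i.e. it commutes with $\sum_{d=1}^m\hat n_{a,d}$ for every $a\in\{1,\dots,n\}$ and with $\sum_{a=1}^n\hat n_{a,d}$ for every $d\in\{1,\dots,m\}$; in particular it maps $\mathcal H_{\mathrm{dual}}$ into itself. (2) For every $p\ge1$ and all $\boldsymbol\gamma,\boldsymbol\beta\in\mathbb R^p$, the dual-constraint QAOA state $$|\psi^{\mathrm{dual}}_p(\boldsymbol\gamma,\boldsymbol\beta)\rangle=e^{-i\beta_pH^{\mathrm{dual}}_{\mathrm{mix}}}e^{-i\gamma_pH_P}\cdots e^{-i\beta_1H^{\mathrm{dual}}_{\mathrm{mix}}}e^{-i\gamma_1H_P}|X^{(0)}\rangle$$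 lies in $\mathcal H_{\mathrm{dual}}$, where $$H^{\mathrm{dual}}_{\mathrm{mix}}=\sum_{1\le i<j\le n}\ \sum_{1\le c<c'\le m}H_\square^{(i,j;c,c')}.$$
   Context: There is one qubit $(i,c)$ for each node $v_i$ ($1\le i\le n$) and each channel $c\in\{1,\dots,m\}$; computational basis states $|x\rangle$ are labelled by binary matrices $x=(x_{i,c})\in\{0,1\}^{n\times m}$. The number operator $\hat n_{i,c}$ is defined by $\hat n_{i,c}|x\rangle=x_{i,c}|x\rangle$. (In exponents such as $e^{-i\beta H}$ the symbol $i$ is the imaginary unit.) For nodes $i<j$ and channels $c<c'$, consider the four qubits $(i,c),(i,c'),(j,c),(j,c')$ in this order, with basis states $|b_1b_2b_3b_4\rangle$. The plaquette Hamiltonian is $$H_\square^{(i,j;c,c')}=|1001\rangle\langle 0110|+|0110\rangle\langle1001|$$ on these four qubits, tensored with the identity on all other qubits. Thus $U_\square(\beta)$ rotates between $|1001\rangle$ and $|0110\rangle$ and fixes all other four-qubit basis states. $H_P$ is the conflict-counting problem Hamiltonian, diagonal in the computational basis, with $H_P|x\rangle=C(x)|x\rangle$, where $C(x)=\sum_{(v_i,v_j)\in E}\sum_{c=1}^m x_{i,c}x_{j,c}$ (each edge counted once). *)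

theory Defs
  imports "HOL-Analysis.Analysis"
begin

text \<open>
  The indices \<open>1..n\<close> of the nodes and \<open>1..m\<close> of the channels are rendered as arbitrary finite
  linearly ordered types \<open>'n\<close> and \<open>'m\<close>.  A binary matrix is an element of \<open>bool ^ 'm ^ 'n\<close>
  (\<open>x $ i $ c\<close> is the entry \<open>x_{i,c}\<close>), and the state space has one coordinate per binary
  matrix.  For a finite basis type \<open>'b\<close>, operators on \<open>complex ^ 'b\<close> are matrices
  (\<open>A $ y $ x\<close> is \<open>\<langle>y|A|x\<rangle>\<close>).  The library operation \<open>*\<close> on vectors and matrices is
  componentwise, so operators are composed with \<open>**\<close> and the library's \<open>exp\<close> does not apply.
\<close>

type_synonym ('n, 'm) config = "bool ^ 'm ^ 'n"
type_synonym 'b state = "complex ^ 'b"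
type_synonym 'b oper = "complex ^ 'b ^ 'b"

definition ket :: "'b::finite \<Rightarrow> 'b state" where
  "ket x = axis x 1"

definition ketbra :: "'b::finite \<Rightarrow> 'b \<Rightarrow> 'b oper" where
  "ketbra u v = (\<chi> y x. of_bool (y = u \<and> x = v))"

definition diag_op :: "('b::finite \<Rightarrow> complex) \<Rightarrow> 'b oper" where
  "diag_op f = (\<chi> y x. if y = x then f x else 0)"

definition op_scale :: "complex \<Rightarrow> 'b::finite oper \<Rightarrow> 'b oper" where
  "op_scale a A = (\<chi> y x. a * A $ y $ x)"

primrec op_power :: "'b::finite oper \<Rightarrow> nat \<Rightarrow> 'b oper" where
  "op_power A 0 = mat 1"
| "op_power A (Suc r) = A ** op_power A r"

definition op_exp :: "'b::finite oper \<Rightarrow> 'b oper" where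
  "op_exp A = (\<Sum>r. (1 / fact r) *\<^sub>R op_power A r)"

lemma ketbra_ket: "ketbra u v *v ket x = (if x = v then ket u else 0)"
  by (simp add: vec_eq_iff matrix_vector_mult_def ketbra_def ket_def axis_def if_distrib
      cong: if_cong)

lemma diag_op_ket: "diag_op f *v ket x = f x *s ket x"
  by (auto simp: vec_eq_iff matrix_vector_mult_def diag_op_def ket_def axis_def if_distrib
      cong: if_cong intro!: sum.neutral)

text \<open>The exponential series converges for every operator, so \<^const>\<open>op_exp\<close> is its actual sum.\<close>

lemma op_power_bound:
  fixes A :: "'b::finite oper"
  assumes "\<And>y x. norm (A $ y $ x) \<le> M"
  shows "norm (op_power A r $ y $ x) \<le> (real CARD('b) * M) ^ r"
proof (induction r arbitrary: y x)
  case 0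
  show ?case by (simp add: mat_def)
next
  case (Suc r)
  have M: "0 \<le> M" using assms norm_ge_zero order_trans by blast
  have "norm (op_power A (Suc r) $ y $ x) \<le> (\<Sum>z\<in>UNIV. norm (A $ y $ z * op_power A r $ z $ x))"
    by (simp add: matrix_matrix_mult_def norm_sum)
  also have "\<dots> \<le> (\<Sum>z\<in>(UNIV::'b set). M * (real CARD('b) * M) ^ r)"
    by (intro sum_mono) (simp add: norm_mult mult_mono' assms Suc.IH M)
  finally show ?case by (simp add: mult_ac)
qed

lemma op_exp_sums: "(\<lambda>r. (1 / fact r) *\<^sub>R op_power A r) sums op_exp A"
proof -
  have entry: "\<exists>l. (\<lambda>r. ((1 / fact r) *\<^sub>R op_power A r) $ y $ x) sums l" for y x
  proof -
    define M where "M = (\<Sum>y\<in>UNIV. \<Sum>x\<in>UNIV. norm (A $ y $ x))"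
    have "norm (A $ y $ x) \<le> M" for y x
    proof -
      have "norm (A $ y $ x) \<le> (\<Sum>x\<in>UNIV. norm (A $ y $ x))"
        by (intro member_le_sum) auto
      also have "\<dots> \<le> M"
        unfolding M_def by (intro member_le_sum) (auto intro: sum_nonneg)
      finally show ?thesis .
    qed
    note bd = op_power_bound[OF this]
    have "summable (\<lambda>r. ((1 / fact r) *\<^sub>R op_power A r) $ y $ x)"
    proof (rule summable_comparison_test')
      show "summable (\<lambda>r. inverse (fact r) * (real CARD('a) * M) ^ r)"
        by (rule summable_exp)
      show "norm (((1 / fact r) *\<^sub>R op_power A r) $ y $ x)
          \<le> inverse (fact r) * (real CARD('a) * M) ^ r" if "r \<ge> 0" for r
        using bd[of r y x] by (simp add: divide_simps)
    qed
    then show ?thesis by (auto simp: summable_def)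
  qed
  then obtain l where l: "\<And>y x. (\<lambda>r. ((1 / fact r) *\<^sub>R op_power A r) $ y $ x) sums l y x"
    by metis
  have "(\<lambda>r. (1 / fact r) *\<^sub>R op_power A r) sums (\<chi> y x. l y x)"
    unfolding sums_def
    by (intro vec_tendstoI) (use l in \<open>simp add: sums_def\<close>)
  then show ?thesis
    by (simp add: op_exp_def sums_iff)
qed

definition number_op :: "'n::finite \<Rightarrow> 'm::finite \<Rightarrow> ('n, 'm) config oper" where
  "number_op i c = diag_op (\<lambda>x. of_bool (x $ i $ c))"

text \<open>
  \<open>h\<close>, acting on the qubits \<open>(i,c), (i,c'), (j,c), (j,c')\<close> in this order, tensored with the
  identity on all other qubits.
\<close>
definition on_four_qubits ::
  "'n::finite \<Rightarrow> 'n \<Rightarrow> 'm::finite \<Rightarrow> 'm \<Rightarrow> (bool \<times> bool \<times> bool \<times> bool) oper \<Rightarrow> ('n, 'm) config oper" where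
  "on_four_qubits i j c c' h =
     (\<chi> y x. h $ (y $ i $ c, y $ i $ c', y $ j $ c, y $ j $ c')
               $ (x $ i $ c, x $ i $ c', x $ j $ c, x $ j $ c')
             * of_bool (\<forall>a d. \<not> (a \<in> {i, j} \<and> d \<in> {c, c'}) \<longrightarrow> y $ a $ d = x $ a $ d))"

definition plaquette_ham ::
  "'n::finite \<Rightarrow> 'n \<Rightarrow> 'm::finite \<Rightarrow> 'm \<Rightarrow> ('n, 'm) config oper" where
  "plaquette_ham i j c c' = on_four_qubits i j c c'
     (ketbra (True, False, False, True) (False, True, True, False)
      + ketbra (False, True, True, False) (True, False, False, True))"

definition plaquette_unitary ::
  "'n::finite \<Rightarrow> 'n \<Rightarrow> 'm::finite \<Rightarrow> 'm \<Rightarrow> real \<Rightarrow> ('n, 'm) config oper" where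
  "plaquette_unitary i j c c' \<beta> = op_exp (op_scale (- \<i> * complex_of_real \<beta>) (plaquette_ham i j c c'))"

definition dual_mixer :: "('n::{finite, linorder}, 'm::{finite, linorder}) config oper" where
  "dual_mixer = (\<Sum>(i, j) \<in> {(i, j). i < j}. \<Sum>(c, c') \<in> {(c, c'). c < c'}. plaquette_ham i j c c')"

text \<open>A simple graph with vertex set \<open>UNIV :: 'n set\<close> is given by its set of edges.\<close>

definition simple_graph :: "'n set set \<Rightarrow> bool" where
  "simple_graph E \<longleftrightarrow> (\<forall>e\<in>E. \<exists>u v. u \<noteq> v \<and> e = {u, v})"

definition conflicts :: "'n::{finite, linorder} set set \<Rightarrow> ('n, 'm::finite) config \<Rightarrow> nat" where
  "conflicts E x =
     (\<Sum>(i, j) \<in> {(i, j). i < j \<and> {i, j} \<in> E}. \<Sum>c\<in>UNIV. of_bool (x $ i $ c) * of_bool (x $ j $ c))"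

definition problem_ham :: "'n::{finite, linorder} set set \<Rightarrow> ('n, 'm::finite) config oper" where
  "problem_ham E = diag_op (\<lambda>x. of_nat (conflicts E x))"

definition dual_feasible ::
  "('n::finite \<Rightarrow> nat) \<Rightarrow> ('m::finite \<Rightarrow> nat) \<Rightarrow> ('n, 'm) config \<Rightarrow> bool" where
  "dual_feasible k L x \<longleftrightarrow>
     (\<forall>i. (\<Sum>c\<in>UNIV. of_bool (x $ i $ c)) = k i) \<and> (\<forall>c. (\<Sum>i\<in>UNIV. of_bool (x $ i $ c)) = L c)"

definition H_dual ::
  "('n::finite \<Rightarrow> nat) \<Rightarrow> ('m::finite \<Rightarrow> nat) \<Rightarrow> ('n, 'm) config state set" where
  "H_dual k L = vec.span (ket ` {x. dual_feasible k L x})"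

text \<open>
  The state after \<open>p\<close> layers, the angles being \<open>\<gamma> 1, \<dots>, \<gamma> p\<close> and \<open>\<beta> 1, \<dots>, \<beta> p\<close>;
  no other values of \<open>\<gamma>\<close> and \<open>\<beta>\<close> are used.
\<close>
primrec dual_qaoa_state ::
  "'n::{finite, linorder} set set \<Rightarrow> ('n, 'm::{finite, linorder}) config
     \<Rightarrow> (nat \<Rightarrow> real) \<Rightarrow> (nat \<Rightarrow> real) \<Rightarrow> nat \<Rightarrow> ('n, 'm) config state" where
  "dual_qaoa_state E X0 \<gamma> \<beta> 0 = ket X0"
| "dual_qaoa_state E X0 \<gamma> \<beta> (Suc p) =
     op_exp (op_scale (- \<i> * complex_of_real (\<beta> (Suc p))) dual_mixer) *v
       (op_exp (op_scale (- \<i> * complex_of_real (\<gamma> (Suc p))) (problem_ham E)) *v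
         dual_qaoa_state E X0 \<gamma> \<beta> p)"

end

(*
  An operator whose matrix entry <y|A|x> vanishes unless f y = f x commutes with every diagonal
  operator depending on x only through f x, and such operators are closed under products, linear
  combinations and limits, hence under the exponential.  A plaquette Hamiltonian has this property
  for every row sum and every column sum: on a row it meets it swaps the entries in columns c, c',
  and on a column it meets it swaps the entries in rows i, j.
*)

theory Submission
  imports Defs
begin

text \<open>\<open>A\<close> is block diagonal along the level sets of \<open>f\<close>. The value
  type is arbitrary so that \<open>f\<close> can be a row or column sum as well as the truth value
  \<open>dual_feasible k L\<close>.\<close>

definition conserves :: "'b::finite oper \<Rightarrow> ('b \<Rightarrow> 'c) \<Rightarrow> bool" where
  "conserves A f \<longleftrightarrow> (\<forall>y x. A $ y $ x \<noteq> 0 \<longrightarrow> f y = f x)"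

lemma conservesI: "(\<And>y x. A $ y $ x \<noteq> 0 \<Longrightarrow> f y = f x) \<Longrightarrow> conserves A f"
  by (simp add: conserves_def)

lemma conservesD: "conserves A f \<Longrightarrow> A $ y $ x \<noteq> 0 \<Longrightarrow> f y = f x"
  by (simp add: conserves_def)

lemma conserves_mat_1: "conserves (mat 1) f"
  by (simp add: conserves_def mat_def)

lemma conserves_diag_op: "conserves (diag_op g) f"
  by (simp add: conserves_def diag_op_def)

lemma conserves_op_scale: "conserves A f \<Longrightarrow> conserves (op_scale a A) f"
  by (simp add: conserves_def op_scale_def)

lemma conserves_mult:
  assumes "conserves A f" "conserves B f"
  shows "conserves (A ** B) f"
proof (rule conservesI)
  fix y x
  assume "(A ** B) $ y $ x \<noteq> 0"
  then obtain z where "A $ y $ z * B $ z $ x \<noteq> 0"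
    unfolding matrix_matrix_mult_def by (auto elim: sum.not_neutral_contains_not_neutral)
  then show "f y = f x"
    using assms by (metis conservesD mult_eq_0_iff)
qed

lemma conserves_sum:
  assumes "\<And>s. s \<in> S \<Longrightarrow> conserves (A s) f"
  shows "conserves (sum A S) f"
proof (rule conservesI)
  fix y x
  assume "sum A S $ y $ x \<noteq> 0"
  then obtain s where "s \<in> S" "A s $ y $ x \<noteq> 0"
    by (auto elim: sum.not_neutral_contains_not_neutral)
  then show "f y = f x"
    using assms conservesD by metis
qed

lemma conserves_op_power: "conserves A f \<Longrightarrow> conserves (op_power A r) f"
  by (induction r) (simp_all add: conserves_mat_1 conserves_mult)

text \<open>Where \<open>f y\<close> and \<open>f x\<close> differ, the entry vanishes in every
  power of \<open>A\<close>, hence in every term of the exponential series.\<close>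

lemma conserves_op_exp:
  assumes "conserves A f"
  shows "conserves (op_exp A) f"
proof (rule conservesI, rule ccontr)
  fix y x
  assume nz: "op_exp A $ y $ x \<noteq> 0" and ne: "f y \<noteq> f x"
  \<comment> \<open>Reading off an entry is a bounded linear map, so the series may be evaluated
    entrywise.\<close>
  have "(\<lambda>r. ((1 / fact r) *\<^sub>R op_power A r) $ y $ x) sums (op_exp A $ y $ x)"
    by (intro bounded_linear.sums[OF bounded_linear_vec_nth] op_exp_sums)
  moreover have "op_power A r $ y $ x = 0" for r
    using conservesD[OF conserves_op_power[OF assms]] ne by metis
  ultimately have "(\<lambda>r. 0) sums (op_exp A $ y $ x)"
    by simp
  then show False
    using nz sums_unique2 sums_zero by blast
qed

text \<open>The two products scale the entry at \<open>y\<close>, \<open>x\<close> by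
  \<open>g (f x)\<close> and by \<open>g (f y)\<close>; these factors agree wherever the entry is
  nonzero.\<close>

lemma conserves_commute_diag_op:
  assumes "conserves A f"
  shows "A ** diag_op (\<lambda>x. g (f x)) = diag_op (\<lambda>x. g (f x)) ** A"
proof -
  have "A $ y $ x * g (f x) = g (f y) * A $ y $ x" for y x
    using conservesD[OF assms, of y x] by (cases "A $ y $ x = 0") auto
  then show ?thesis
    by (simp add: vec_eq_iff matrix_matrix_mult_def diag_op_def if_distrib if_distribR
        cong: if_cong)
qed

definition row_sum :: "'n::finite \<Rightarrow> ('n, 'm::finite) config \<Rightarrow> nat" where
  "row_sum a x = (\<Sum>d\<in>UNIV. of_bool (x $ a $ d))"

definition col_sum :: "'m::finite \<Rightarrow> ('n::finite, 'm) config \<Rightarrow> nat" where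
  "col_sum d x = (\<Sum>a\<in>UNIV. of_bool (x $ a $ d))"

lemma dual_feasible_iff_sums:
  "dual_feasible k L x \<longleftrightarrow> (\<forall>a. row_sum a x = k a) \<and> (\<forall>d. col_sum d x = L d)"
  by (simp add: dual_feasible_def row_sum_def col_sum_def)

lemma sum_diag_op: "(\<Sum>s\<in>S. diag_op (f s)) = diag_op (\<lambda>x. \<Sum>s\<in>S. f s x)"
  by (simp add: vec_eq_iff diag_op_def)

text \<open>Puts the operator into the form that \<open>conserves_commute_diag_op\<close> accepts,
  with \<open>g\<close> the cast from naturals to complex numbers.\<close>

lemma sum_number_op_row: "(\<Sum>d\<in>UNIV. number_op a d) = diag_op (\<lambda>x. of_nat (row_sum a x))"
  by (simp add: number_op_def sum_diag_op row_sum_def del: sum_of_bool_eq)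

lemma sum_number_op_col: "(\<Sum>a\<in>UNIV. number_op a d) = diag_op (\<lambda>x. of_nat (col_sum d x))"
  by (simp add: number_op_def sum_diag_op col_sum_def del: sum_of_bool_eq)

lemma conserves_dual_feasible:
  assumes "\<And>a. conserves A (row_sum a)" "\<And>d. conserves A (col_sum d)"
  shows "conserves A (dual_feasible k L)"
  using assms by (simp add: conserves_def dual_feasible_iff_sums)

text \<open>On the four qubits one of \<open>x\<close>, \<open>y\<close> reads 1001 and the other
  0110. Passing between these patterns can be seen as swapping the two columns (first four
  equations) or as swapping the two rows (next four).\<close>

lemma plaquette_ham_nonzeroD:
  assumes "plaquette_ham i j c c' $ y $ x \<noteq> 0"
  shows "y $ i $ c = x $ i $ c'" "y $ i $ c' = x $ i $ c"
    "y $ j $ c = x $ j $ c'" "y $ j $ c' = x $ j $ c"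
    "y $ i $ c = x $ j $ c" "y $ j $ c = x $ i $ c"
    "y $ i $ c' = x $ j $ c'" "y $ j $ c' = x $ i $ c'"
    "\<And>a d. \<not> (a \<in> {i, j} \<and> d \<in> {c, c'}) \<Longrightarrow> y $ a $ d = x $ a $ d"
  using assms
  by (auto simp: plaquette_ham_def on_four_qubits_def ketbra_def of_bool_def split: if_splits)

lemma conserves_plaquette_ham_row_sum: "conserves (plaquette_ham i j c c') (row_sum a)"
proof (rule conservesI)
  fix y x
  assume nz: "plaquette_ham i j c c' $ y $ x \<noteq> 0"
  show "row_sum a y = row_sum a x"
  proof (cases "a \<in> {i, j}")
    case True
    \<comment> \<open>The transposition acts on all columns and fixes those other than
      \<open>c\<close> and \<open>c'\<close>, so one equation covers the whole row and the sum can
      be reindexed along a bijection.\<close>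
    then have "y $ a $ d = x $ a $ Transposition.transpose c c' d" for d
      using plaquette_ham_nonzeroD[OF nz] by (auto simp: Transposition.transpose_def)
    then have "row_sum a y = (\<Sum>d\<in>UNIV. of_bool (x $ a $ Transposition.transpose c c' d))"
      by (simp only: row_sum_def)
    also have "\<dots> = row_sum a x"
      unfolding row_sum_def
      by (rule sum.reindex_bij_betw[OF bij_transpose, where g = "\<lambda>d. of_bool (x $ a $ d)"])
    finally show ?thesis .
  next
    case False
    then show ?thesis
      using plaquette_ham_nonzeroD(9)[OF nz] by (simp add: row_sum_def)
  qed
qed

text \<open>The argument for row sums with the roles exchanged: the transposition now permutes the
  row index.\<close>

lemma conserves_plaquette_ham_col_sum: "conserves (plaquette_ham i j c c') (col_sum d)"
proof (rule conservesI)
  fix y x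
  assume nz: "plaquette_ham i j c c' $ y $ x \<noteq> 0"
  show "col_sum d y = col_sum d x"
  proof (cases "d \<in> {c, c'}")
    case True
    then have "y $ a $ d = x $ Transposition.transpose i j a $ d" for a
      using plaquette_ham_nonzeroD[OF nz] by (auto simp: Transposition.transpose_def)
    then have "col_sum d y = (\<Sum>a\<in>UNIV. of_bool (x $ Transposition.transpose i j a $ d))"
      by (simp only: col_sum_def)
    also have "\<dots> = col_sum d x"
      unfolding col_sum_def
      by (rule sum.reindex_bij_betw[OF bij_transpose, where g = "\<lambda>a. of_bool (x $ a $ d)"])
    finally show ?thesis .
  next
    case False
    then show ?thesis
      using plaquette_ham_nonzeroD(9)[OF nz] by (simp add: col_sum_def)
  qed
qed

text \<open>Replaces the span by a condition on supports, which can be checked coordinate by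
  coordinate against matrix entries.\<close>

lemma span_ket_eq: "vec.span (ket ` S) = {\<psi>. \<forall>x. \<psi> $ x \<noteq> 0 \<longrightarrow> x \<in> S}"
proof (intro equalityI subsetI)
  fix \<psi> :: "'a state"
  assume "\<psi> \<in> vec.span (ket ` S)"
  then show "\<psi> \<in> {\<psi>. \<forall>x. \<psi> $ x \<noteq> 0 \<longrightarrow> x \<in> S}"
  proof (induction rule: vec.span_induct_alt)
    case base
    show ?case by simp
  next
    case (step a v w)
    then have "x \<in> S" if "(a *s v + w) $ x \<noteq> 0" for x
      using that by (cases "w $ x = 0") (auto simp: ket_def axis_def split: if_splits)
    then show ?case by blast
  qed
next
  fix \<psi> :: "'a state"
  assume supp: "\<psi> \<in> {\<psi>. \<forall>x. \<psi> $ x \<noteq> 0 \<longrightarrow> x \<in> S}"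
  \<comment> \<open>Each term of the basis expansion is a multiple of an admissible basis state or
    is zero.\<close>
  have "\<psi> $ x *s ket x \<in> vec.span (ket ` S)" for x
    using supp by (cases "\<psi> $ x = 0") (auto intro: vec.span_scale vec.span_base vec.span_zero)
  then have "(\<Sum>x\<in>UNIV. \<psi> $ x *s ket x) \<in> vec.span (ket ` S)"
    by (intro vec.span_sum)
  then show "\<psi> \<in> vec.span (ket ` S)"
    unfolding ket_def basis_expansion .
qed

text \<open>A nonzero coordinate \<open>y\<close> of the image arises from some \<open>x\<close> in
  the support of \<psi> with \<open>A $ y $ x\<close> nonzero, and feasibility passes from
  \<open>x\<close> to \<open>y\<close>.\<close>

lemma conserves_preserves_H_dual:
  assumes "conserves A (dual_feasible k L)" and "\<psi> \<in> H_dual k L"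
  shows "A *v \<psi> \<in> H_dual k L"
proof -
  have "dual_feasible k L y" if "(A *v \<psi>) $ y \<noteq> 0" for y
  proof -
    from that obtain x where "A $ y $ x * \<psi> $ x \<noteq> 0"
      unfolding matrix_vector_mult_def by (auto elim: sum.not_neutral_contains_not_neutral)
    then show ?thesis
      using assms conservesD[OF assms(1), of y x] by (auto simp: H_dual_def span_ket_eq)
  qed
  then show ?thesis
    by (simp add: H_dual_def span_ket_eq)
qed

lemma conserves_dual_mixer:
  "(\<And>i j c c'. conserves (plaquette_ham i j c c') f) \<Longrightarrow> conserves dual_mixer f"
  unfolding dual_mixer_def by (auto intro!: conserves_sum)

text \<open>Induction on the layers. The mixer is exponentiated as a whole: conservation passes from
  the plaquettes to their sum and only then to the exponential, so the exponential is never split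
  into plaquette factors.\<close>

lemma dual_qaoa_state_in_H_dual:
  assumes "dual_feasible k L X0"
  shows "dual_qaoa_state E X0 \<gamma> \<beta> p \<in> H_dual k L"
proof (induction p)
  case 0
  show ?case
    using assms by (auto simp: H_dual_def intro: vec.span_base)
next
  case (Suc p)
  have "conserves dual_mixer (dual_feasible k L)"
    by (intro conserves_dual_mixer conserves_dual_feasible
        conserves_plaquette_ham_row_sum conserves_plaquette_ham_col_sum)
  moreover have "conserves (problem_ham E) (dual_feasible k L)"
    unfolding problem_ham_def by (rule conserves_diag_op)
  ultimately show ?case
    by (simp add: Suc conserves_preserves_H_dual conserves_op_exp conserves_op_scale)
qed

theorem mainTheorem2:
  fixes E :: "'n::{finite, linorder} set set"
    and k :: "'n \<Rightarrow> nat"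
    and L :: "'m::{finite, linorder} \<Rightarrow> nat"
    and X0 :: "('n, 'm) config"
  assumes "simple_graph E"
    and "\<And>i. (\<Sum>c\<in>UNIV. of_bool (X0 $ i $ c)) = k i"
    and "\<And>c. (\<Sum>i\<in>UNIV. of_bool (X0 $ i $ c)) = L c"
  shows
    "(\<forall>(i::'n) j (c::'m) c' \<beta>. i < j \<and> c < c' \<longrightarrow>
        (\<forall>a. plaquette_unitary i j c c' \<beta> ** (\<Sum>d\<in>UNIV. number_op a d)
           = (\<Sum>d\<in>UNIV. number_op a d) ** plaquette_unitary i j c c' \<beta>) \<and>
        (\<forall>d. plaquette_unitary i j c c' \<beta> ** (\<Sum>a\<in>UNIV. number_op a d)
           = (\<Sum>a\<in>UNIV. number_op a d) ** plaquette_unitary i j c c' \<beta>) \<and>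
        (\<forall>\<psi>\<in>H_dual k L. plaquette_unitary i j c c' \<beta> *v \<psi> \<in> H_dual k L))
     \<and> (\<forall>p\<ge>1. \<forall>\<gamma> \<beta>. dual_qaoa_state E X0 \<gamma> \<beta> p \<in> H_dual k L)"
proof -
  have row: "conserves (plaquette_unitary i j c c' \<beta>) (row_sum a)"
    and col: "conserves (plaquette_unitary i j c c' \<beta>) (col_sum d)"
    for i j a :: 'n and c c' d :: 'm and \<beta>
    unfolding plaquette_unitary_def
    by (intro conserves_op_exp conserves_op_scale conserves_plaquette_ham_row_sum
        conserves_plaquette_ham_col_sum)+
  have "dual_feasible k L X0"
    using assms by (simp add: dual_feasible_def)
  then show ?thesis
    unfolding sum_number_op_row sum_number_op_col
    \<comment> \<open>Fixing \<open>g\<close> lets the commutation lemma match the rewritten sums of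
      number operators.\<close>
    by (simp add: conserves_commute_diag_op[OF row, where g = of_nat]
        conserves_commute_diag_op[OF col, where g = of_nat] conserves_preserves_H_dual
        conserves_dual_feasible dual_qaoa_state_in_H_dual row col)
qed

end
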